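(* Let $m,n$ be integers with $2\leq m<n$, and let $L:M_{m,n}(\mathbb{R})\to M_{m,n}(\mathbb{R})$ be an invertible linear map. If $L(S_{m,n})\subseteq S_{m,n}$, then there exist an invertible row positive matrix $X\in M_m(\mathbb{R})$ and an inverse nonnegative matrix $Y\in M_n(\mathbb{R})$ such that $L(A)=XAY$ for all $A\in M_{m,n}(\mathbb{R})$.
   Context: $M_{m,n}(\mathbb{R})$ is the space of real $m\times n$ matrices and $M_n(\mathbb{R})=M_{n,n}(\mathbb{R})$. $\mathbb{R}_+^n=\{x\in\mathbb{R}^n: x_i\geq 0 \text{ for every } i\}$ and $\mathbb{R}_{++}^n=\{x\in\mathbb{R}^n: x_i>0\text{ for every } i\}$. A matrix $A\in M_{m,n}(\mathbb{R})$ is semipositive if there exists $x\in\mathbb{R}_+^n$ such that $Ax\in\mathbb{R}_{++}^m$; $S_{m,n}$ denotes the set of all semipositive matrices in $M_{m,n}(\mathbb{R})$. A square matrix is row positive if it is entrywise nonnegative and every row contains a nonzero entry. An invertible square matrix $Y$ is inverse nonnegative if $Y^{-1}$ is entrywise nonnegative. *)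

theory Defs
  imports "HOL-Analysis.Analysis"
begin

text \<open>The type \<open>real ^ 'n ^ 'm\<close> is the space of real matrices with
  \<open>CARD('m)\<close> rows and \<open>CARD('n)\<close> columns; \<open>A $ i $ j\<close> is the entry in row \<open>i\<close>, column \<open>j\<close>.\<close>

definition nonneg_orthant :: "(real ^ 'n) set" where
  "nonneg_orthant = {x. \<forall>i. x $ i \<ge> 0}"

definition pos_orthant :: "(real ^ 'n) set" where
  "pos_orthant = {x. \<forall>i. x $ i > 0}"

definition semipositive :: "real ^ 'n ^ 'm \<Rightarrow> bool" where
  "semipositive A \<longleftrightarrow> (\<exists>x \<in> nonneg_orthant. A *v x \<in> pos_orthant)"

definition semipositive_matrices :: "(real ^ 'n ^ 'm) set" where
  "semipositive_matrices = {A. semipositive A}"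

definition entrywise_nonneg :: "real ^ 'n ^ 'm \<Rightarrow> bool" where
  "entrywise_nonneg A \<longleftrightarrow> (\<forall>i j. A $ i $ j \<ge> 0)"

definition row_positive :: "real ^ 'n ^ 'n \<Rightarrow> bool" where
  "row_positive X \<longleftrightarrow> entrywise_nonneg X \<and> (\<forall>i. \<exists>j. X $ i $ j \<noteq> 0)"

definition inverse_nonnegative :: "real ^ 'n ^ 'n \<Rightarrow> bool" where
  "inverse_nonnegative Y \<longleftrightarrow> invertible Y \<and> entrywise_nonneg (matrix_inv Y)"

end

theory Submission
  imports Defs
begin

text \<open>Everything follows from one consequence of semipositivity: if \<open>L A\<close> is semipositive and
  \<open>y \<ge> 0\<close> is nonzero, then \<open>y v* L A \<noteq> 0\<close>, because \<open>y\<close> has positive inner product with a positive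
  vector \<open>L A *v z\<close>. So for a fixed \<open>x \<ge> 0\<close> the subspace of all \<open>A *v x\<close> with \<open>y v* L A = 0\<close> misses
  the open orthant, and a separating hyperplane gives a nonzero \<open>p \<ge> 0\<close> orthogonal to it. By duality
  \<open>p \<bullet> (A *v x) = y \<bullet> (L A *v w)\<close> for some \<open>w\<close> and all \<open>A\<close>
  (\<open>preserver_rank_one_pairing\<close>); that is, the adjoint of \<open>L\<close> sends the rank-one matrix
  \<open>outer y w\<close> to \<open>outer p x\<close>.

  A priori \<open>p\<close> depends on \<open>x\<close>. Taking for \<open>x\<close> the unit vectors and then the all-ones vector, which
  is their sum, shows that the vectors \<open>p\<close> of all unit vectors are parallel to a single one. Hence
  \<open>y v* L A = p v* A v* Y\<close> with \<open>p\<close> and an invertible \<open>Y\<close> that depend only on \<open>y\<close>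
  (\<open>preserver_row_combination\<close>).

  For \<open>y\<close> a unit vector this describes one row of \<open>L A\<close>. Surjectivity of \<open>L\<close> makes the vectors \<open>p\<close>
  of different rows non-parallel, and then the same formula for the sum of two unit vectors forces the
  matrices \<open>Y\<close> of the two rows to be proportional. So one \<open>Y\<close> serves all rows, and
  \<open>L A = X ** A ** Y\<close>, where each row of \<open>X\<close> is nonzero and nonnegative up to sign
  (\<open>preserver_factorization\<close>).

  The signs are read off from the semipositive matrices \<open>outer e v\<close>, where \<open>e\<close> is the all-ones vector
  and \<open>v\<close> has a positive coordinate. Their images are \<open>outer (X *v e) (v v* Y)\<close>, and semipositivity
  forces the entries of \<open>X *v e\<close> to have one common sign. After moving that sign from \<open>X\<close> to
  \<open>Y\<close>, it also forces \<open>v v* Y\<close> to have a positive coordinate whenever \<open>v\<close> has one, which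
  is nonnegativity of the inverse of \<open>Y\<close>.\<close>

section \<open>Linear algebra\<close>

definition outer :: "real ^ 'm \<Rightarrow> real ^ 'n \<Rightarrow> real ^ 'n ^ 'm" where
  "outer b u = (\<chi> i j. b $ i * u $ j)"

lemma vector_mult_outer: "p v* outer b u = (p \<bullet> b) *\<^sub>R u"
  by (simp add: outer_def vector_matrix_mult_def vec_eq_iff inner_vec_def sum_distrib_left
      mult_ac)

lemma outer_mult_vector: "outer b u *v x = (u \<bullet> x) *\<^sub>R b"
  by (simp add: outer_def matrix_vector_mult_def vec_eq_iff inner_vec_def sum_distrib_left
      mult_ac)

lemma linear_matrix_vector_arg: "linear (\<lambda>A :: real ^ 'n ^ 'm. A *v x)"
  by (rule linearI) (auto simp: matrix_vector_mult_def vec_eq_iff sum.distrib sum_distrib_left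
      algebra_simps)

lemma linear_vector_matrix_arg: "linear (\<lambda>A :: real ^ 'n ^ 'm. y v* A)"
  by (rule linearI) (auto simp: vector_matrix_mult_def vec_eq_iff sum.distrib sum_distrib_left
      algebra_simps)

lemma axis_vector_mult: "axis i 1 v* B = row i (B :: real ^ 'n ^ 'm)"
  by (simp add: vector_matrix_mult_def axis_def row_def vec_eq_iff if_distrib if_distribR
      cong del: if_weak_cong)

lemma vector_matrix_mult_minus: "(- v) v* A = - (v v* (A :: real ^ 'n ^ 'm))"
  by (simp add: vector_matrix_mult_def vec_eq_iff sum_negf)

lemma invertible_if_kernel_trivial:
  fixes A :: "real ^ 'n ^ 'n"
  assumes "\<And>u. A *v u = 0 \<Longrightarrow> u = 0"
  shows "invertible A"
  using assms by (simp add: invertible_left_inverse matrix_left_invertible_ker)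

lemma matrix_inv_cancel:
  fixes A :: "real ^ 'n ^ 'n"
  assumes "invertible A"
  shows "A ** matrix_inv A = mat 1" and "matrix_inv A ** A = mat 1"
  using someI_ex[OF assms[unfolded invertible_def]] unfolding matrix_inv_def by auto

lemma vector_mult_invertible_eq_0_iff:
  fixes Y :: "real ^ 'n ^ 'n"
  assumes "invertible Y"
  shows "v v* Y = 0 \<longleftrightarrow> v = 0"
  by (metis assms matrix_inv_cancel(1) vector_matrix_mul_assoc vector_matrix_mul_rid
      vector_matrix_mult_0)

text \<open>A functional vanishing on the kernel of a surjection descends to the target, where it is
  an inner product with a fixed vector.\<close>

lemma functional_factors_through_surjection:
  fixes f :: "'a :: euclidean_space \<Rightarrow> real" and g :: "'a \<Rightarrow> 'b :: euclidean_space"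
  assumes f: "linear f" and g: "linear g" and "surj g"
    and ker: "\<And>a. g a = 0 \<Longrightarrow> f a = 0"
  shows "\<exists>w. \<forall>a. f a = g a \<bullet> w"
proof -
  obtain h where h: "linear h" and gh: "g \<circ> h = id"
    using linear_surjective_right_inverse[OF g \<open>surj g\<close>] by blast
  have fh: "linear (f \<circ> h)"
    using h f by (rule linear_compose)
  have "f a = g a \<bullet> adjoint (f \<circ> h) 1" for a
  proof -
    have "g (a - h (g a)) = 0"
      using gh by (simp add: linear_diff[OF g] fun_eq_iff)
    hence "f a = f (h (g a))"
      using ker linear_diff[OF f] by force
    thus ?thesis
      by (simp add: adjoint_works[OF fh])
  qed
  thus ?thesis by blast
qed

lemma orthogonal_vector_if_not_multiple:
  fixes a b :: "'a :: real_inner"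
  assumes "b \<noteq> 0" and "\<And>c. a \<noteq> c *\<^sub>R b"
  obtains z where "b \<bullet> z = 0" and "a \<bullet> z = 1"
proof -
  \<comment> \<open>the component of \<open>a\<close> orthogonal to \<open>b\<close>, to be rescaled\<close>
  define z where "z = a - ((a \<bullet> b) / (b \<bullet> b)) *\<^sub>R b"
  have bz: "b \<bullet> z = 0"
    using \<open>b \<noteq> 0\<close> by (simp add: z_def inner_diff_right inner_commute)
  have "z \<noteq> 0"
    using assms(2) by (simp add: z_def)
  moreover have "z \<bullet> z = a \<bullet> z"
    using bz by (simp add: z_def inner_diff_left inner_commute)
  ultimately have "a \<bullet> z \<noteq> 0"
    by (metis inner_eq_zero_iff)
  thus thesis
    using that[of "(1 / (a \<bullet> z)) *\<^sub>R z"] bz by simp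
qed

section \<open>Orthants and separation\<close>

lemma nonneg_orthant_nonzero_inner_pos:
  assumes "y \<in> nonneg_orthant" "y \<noteq> 0" "v \<in> pos_orthant"
  shows "0 < y \<bullet> v"
proof -
  obtain i where "y $ i \<noteq> 0"
    using \<open>y \<noteq> 0\<close> by (auto simp: vec_eq_iff)
  have nn: "\<And>j. 0 \<le> y $ j * v $ j"
    using assms by (auto simp: nonneg_orthant_def pos_orthant_def less_imp_le)
  have "0 < y $ i * v $ i"
    using assms \<open>y $ i \<noteq> 0\<close> by (auto simp: nonneg_orthant_def pos_orthant_def less_le)
  also have "\<dots> \<le> y \<bullet> v"
    using member_le_sum[of i UNIV "\<lambda>j. y $ j * v $ j"] nn by (simp add: inner_vec_def)
  finally show ?thesis .
qed

text \<open>A theorem of the alternative in the style of Gordan and Stiemke. A hyperplane separating the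
  subspace from the open orthant is bounded on the subspace, so its normal is orthogonal to the
  subspace; its lower bound on the open orthant makes the normal nonnegative.\<close>

lemma subspace_avoiding_pos_orthant:
  fixes P :: "(real ^ 'm) set"
  assumes P: "subspace P" and disj: "P \<inter> pos_orthant = {}"
  obtains p where "p \<in> nonneg_orthant" and "p \<noteq> 0" and "\<And>v. v \<in> P \<Longrightarrow> p \<bullet> v = 0"
proof -
  have cvx: "convex (pos_orthant :: (real ^ 'm) set)"
    by (auto simp: convex_def pos_orthant_def)
       (metis add.commute add_nonneg_pos add_pos_nonneg less_eq_real_def mult_nonneg_nonneg
         mult_pos_pos zero_less_one add_0)
  have "(\<chi> i. (1 :: real)) \<in> (pos_orthant :: (real ^ 'm) set)"
    by (simp add: pos_orthant_def)
  then obtain p b where "p \<noteq> 0" and le: "\<And>v. v \<in> P \<Longrightarrow> p \<bullet> v \<le> b"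
    and ge: "\<And>v. v \<in> pos_orthant \<Longrightarrow> b \<le> p \<bullet> v"
    using separating_hyperplane_sets[OF subspace_imp_convex[OF P] cvx _ _ disj]
      subspace_0[OF P] by blast
  have "0 \<le> b"
    using le[OF subspace_0[OF P]] by simp
  have orth: "p \<bullet> v = 0" if "v \<in> P" for v
  proof (rule ccontr)
    assume nz: "p \<bullet> v \<noteq> 0"
    have "p \<bullet> (((b + 1) / (p \<bullet> v)) *\<^sub>R v) \<le> b"
      by (rule le) (simp add: subspace_scale[OF P] that)
    thus False
      using nz by simp
  qed
  have "0 \<le> p $ i" for i
  proof (rule field_le_epsilon)
    fix e :: real assume "0 < e"
    \<comment> \<open>The unit vector lies only on the boundary of the orthant, so it is pushed into the interior;
      the size \<open>e / s\<close> of the push changes the inner product with \<open>p\<close> by at most \<open>e\<close>.\<close>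
    define s where "s = (\<Sum>j\<in>UNIV. \<bar>p $ j\<bar>) + 1"
    have "0 < s"
      unfolding s_def by (simp add: sum_nonneg add_nonneg_pos)
    have "b \<le> p \<bullet> (axis i 1 + (\<chi> j. e / s))"
      using \<open>0 < e\<close> \<open>0 < s\<close> by (intro ge) (simp add: pos_orthant_def axis_def add_nonneg_pos)
    also have "\<dots> = p $ i + (\<Sum>j\<in>UNIV. p $ j) * (e / s)"
      by (simp add: inner_add_right inner_axis)
         (simp add: inner_vec_def flip: sum_distrib_right sum_divide_distrib)
    also have "\<dots> \<le> p $ i + s * (e / s)"
    proof -
      have "(\<Sum>j\<in>UNIV. p $ j) \<le> (\<Sum>j\<in>UNIV. \<bar>p $ j\<bar>)"
        by (intro sum_mono) simp
      thus ?thesis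
        using \<open>0 < e\<close> \<open>0 < s\<close> by (intro add_left_mono mult_right_mono) (auto simp: s_def)
    qed
    finally show "0 \<le> p $ i + e"
      using \<open>0 \<le> b\<close> \<open>0 < s\<close> by simp
  qed
  hence "p \<in> nonneg_orthant"
    by (simp add: nonneg_orthant_def)
  thus thesis
    using that \<open>p \<noteq> 0\<close> orth by blast
qed

section \<open>Rows of a semipositivity preserver\<close>

lemma preserver_row_surj:
  fixes L :: "real ^ 'n ^ 'm \<Rightarrow> real ^ 'n ^ 'm"
  assumes "surj L" and "y \<noteq> 0"
  shows "surj (\<lambda>A. y v* L A)"
proof (rule surjI)
  fix x :: "real ^ 'n"
  show "y v* L (inv L (outer ((1 / (y \<bullet> y)) *\<^sub>R y) x)) = x"
    using assms by (simp add: surj_f_inv_f vector_mult_outer)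
qed

text \<open>If \<open>A *v x\<close> is positive for a nonnegative \<open>x\<close>, then \<open>A\<close> and hence \<open>L A\<close> is semipositive,
  so \<open>y v* L A \<noteq> 0\<close>. Separation turns this into a functional \<open>A \<mapsto> p \<bullet> (A *v x)\<close> that vanishes
  wherever \<open>y v* L A\<close> does, and it therefore factors through \<open>y v* L A\<close>.\<close>

lemma preserver_rank_one_pairing:
  fixes L :: "real ^ 'n ^ 'm \<Rightarrow> real ^ 'n ^ 'm"
  assumes L: "linear L" "surj L" "L ` semipositive_matrices \<subseteq> semipositive_matrices"
    and y: "y \<in> nonneg_orthant" "y \<noteq> 0" and x: "x \<in> nonneg_orthant"
  obtains p w where "p \<in> nonneg_orthant" and "p \<noteq> 0"
    and "\<And>A. p \<bullet> (A *v x) = y \<bullet> (L A *v w)"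
proof -
  define g where "g A = y v* L A" for A
  have g: "linear g"
    unfolding g_def using linear_compose[OF L(1) linear_vector_matrix_arg] by (simp add: o_def)
  define P where "P = (\<lambda>A. A *v x) ` {A. g A = 0}"
  have "subspace P"
    unfolding P_def
    by (intro linear_subspace_image linear_matrix_vector_arg linear_subspace_kernel g)
  moreover have "P \<inter> pos_orthant = {}"
  proof -
    have "g A \<noteq> 0" if "A *v x \<in> pos_orthant" for A
    proof
      assume "g A = 0"
      have "L A \<in> semipositive_matrices"
        using that x L(3) by (auto simp: semipositive_matrices_def semipositive_def)
      then obtain z where "L A *v z \<in> pos_orthant"
        by (auto simp: semipositive_matrices_def semipositive_def)
      hence "0 < y \<bullet> (L A *v z)"
        by (rule nonneg_orthant_nonzero_inner_pos[OF y])
      thus False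
        using \<open>g A = 0\<close> by (simp add: g_def flip: dot_lmul_matrix)
    qed
    thus ?thesis
      by (auto simp: P_def)
  qed
  ultimately obtain p where p: "p \<in> nonneg_orthant" "p \<noteq> 0" "\<And>v. v \<in> P \<Longrightarrow> p \<bullet> v = 0"
    by (rule subspace_avoiding_pos_orthant) blast
  have "linear (\<lambda>A. p \<bullet> (A *v x))"
    using linear_compose[OF linear_matrix_vector_arg bounded_linear.linear[OF bounded_linear_inner_right]]
    by (simp add: o_def)
  moreover have "surj g"
    using preserver_row_surj[OF L(2) y(2)] by (simp add: g_def[abs_def])
  ultimately obtain w where "\<And>A. p \<bullet> (A *v x) = g A \<bullet> w"
    using functional_factors_through_surjection[OF _ g, of "\<lambda>A. p \<bullet> (A *v x)"] p(3)
    by (auto simp: P_def)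
  thus thesis
    using that p by (simp add: g_def dot_lmul_matrix)
qed

text \<open>The pairing for \<open>x = axis j 1\<close> gives vectors \<open>q j\<close> and \<open>w j\<close>. The \<open>w j\<close> form a basis because
  the rank-one matrices with \<open>q j\<close> in column \<open>j\<close> are independent. The pairing for the all-ones vector
  gives \<open>p\<close> and a vector \<open>v\<close> with coordinates \<open>c\<close> in that basis, and comparing columns yields
  \<open>p = c j * q j\<close>. Rescaling the basis by \<open>c\<close> thus replaces all the \<open>q j\<close> by \<open>p\<close>.\<close>

lemma preserver_row_combination:
  fixes L :: "real ^ 'n ^ 'm \<Rightarrow> real ^ 'n ^ 'm"
  assumes L: "linear L" "surj L" "L ` semipositive_matrices \<subseteq> semipositive_matrices"
    and y: "y \<in> nonneg_orthant" "y \<noteq> 0"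
  shows "\<exists>p Y. p \<in> nonneg_orthant \<and> p \<noteq> 0 \<and> invertible Y \<and> (\<forall>A. y v* L A = p v* A v* Y)"
proof -
  have "axis j 1 \<in> nonneg_orthant" for j :: 'n
    by (simp add: nonneg_orthant_def axis_def)
  hence "\<exists>q w. q \<noteq> 0 \<and> (\<forall>A. q \<bullet> (A *v axis j 1) = y \<bullet> (L A *v w))" for j
    using preserver_rank_one_pairing[OF L y, of "axis j 1"] by metis
  then obtain q w where q0: "\<And>j. q j \<noteq> 0"
    and q: "\<And>j A. q j \<bullet> (A *v axis j 1) = y \<bullet> (L A *v w j)"
    by metis
  define W where "W = (\<chi> i j. w j $ i)"
  have W: "W *v c = (\<Sum>j\<in>UNIV. c $ j *\<^sub>R w j)" for c
    by (simp add: W_def matrix_vector_mult_def vec_eq_iff mult_ac)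
  have yW: "y \<bullet> (L A *v (W *v c)) = (\<Sum>j\<in>UNIV. c $ j * (q j \<bullet> (A *v axis j 1)))" for A c
    by (simp add: W linear_sum[OF matrix_vector_mul_linear] inner_sum_right
        matrix_vector_mult_scaleR q)
  \<comment> \<open>Matrices supported in a single column isolate one summand.\<close>
  have yWcol: "y \<bullet> (L (outer b (axis k 1)) *v (W *v c)) = c $ k * (q k \<bullet> b)" for b k c
  proof -
    have "y \<bullet> (L (outer b (axis k 1)) *v (W *v c))
        = (\<Sum>j\<in>UNIV. if j = k then c $ k * (q k \<bullet> b) else 0)"
      unfolding yW by (intro sum.cong) (auto simp: outer_mult_vector inner_axis_axis)
    thus ?thesis by simp
  qed
  have "invertible W"
  proof (rule invertible_if_kernel_trivial)
    fix c assume "W *v c = 0"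
    have "c $ k = 0" for k
      using yWcol[of "q k" k c] \<open>W *v c = 0\<close> q0[of k] by simp
    thus "c = 0"
      by (simp add: vec_eq_iff)
  qed
  have "(\<chi> j. 1) \<in> nonneg_orthant"
    by (simp add: nonneg_orthant_def)
  then obtain p v where p: "p \<in> nonneg_orthant" "p \<noteq> 0"
    and pv: "\<And>A. p \<bullet> (A *v (\<chi> j. 1)) = y \<bullet> (L A *v v)"
    using preserver_rank_one_pairing[OF L y, of "\<chi> j. 1"] by metis
  define c where "c = matrix_inv W *v v"
  have v: "v = W *v c"
    by (simp add: c_def matrix_vector_mul_assoc matrix_inv_cancel \<open>invertible W\<close>)
  have cq: "p = c $ j *\<^sub>R q j" for j
  proof -
    have "p \<bullet> b = (c $ j *\<^sub>R q j) \<bullet> b" for b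
      using pv[of "outer b (axis j 1)"] yWcol[of b j c]
      by (simp add: v outer_mult_vector inner_axis')
    thus ?thesis
      by (metis inner_commute vector_eq_rdot)
  qed
  define Z where "Z = (\<chi> i j. c $ j * w j $ i)"
  have Z: "Z *v u = W *v (\<chi> j. c $ j * u $ j)" for u
    by (simp add: Z_def W_def matrix_vector_mult_def vec_eq_iff mult_ac)
  have yZ: "y \<bullet> (L A *v (Z *v u)) = p \<bullet> (A *v u)" for A u
  proof -
    have "y \<bullet> (L A *v (Z *v u)) = (\<Sum>j\<in>UNIV. u $ j * ((c $ j *\<^sub>R q j) \<bullet> (A *v axis j 1)))"
      by (simp add: Z yW mult_ac)
    also have "\<dots> = (\<Sum>j\<in>UNIV. p \<bullet> (A *v (u $ j *\<^sub>R axis j 1)))"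
      by (simp flip: cq add: matrix_vector_mult_scaleR)
    also have "\<dots> = p \<bullet> (A *v (\<Sum>j\<in>UNIV. u $ j *\<^sub>R axis j 1))"
      by (simp add: linear_sum[OF matrix_vector_mul_linear] inner_sum_right)
    also have "(\<Sum>j\<in>UNIV. u $ j *\<^sub>R axis j 1) = u"
      using basis_expansion[of u] by (simp add: scalar_mult_eq_scaleR)
    finally show ?thesis .
  qed
  have "invertible Z"
  proof (rule invertible_if_kernel_trivial)
    fix u assume "Z *v u = 0"
    hence "(u \<bullet> u) * (p \<bullet> p) = 0"
      using yZ[of "outer p u" u] by (simp add: outer_mult_vector)
    thus "u = 0"
      using \<open>p \<noteq> 0\<close> by simp
  qed
  have "y v* L A = p v* A v* matrix_inv Z" for A
  proof -
    have "((y v* L A) v* Z) \<bullet> u = (p v* A) \<bullet> u" for u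
      using yZ[of A u] by (simp add: dot_lmul_matrix)
    hence "(y v* L A) v* Z = p v* A"
      by (metis inner_commute vector_eq_rdot)
    thus ?thesis
      by (metis \<open>invertible Z\<close> matrix_inv_cancel(1) vector_matrix_mul_assoc vector_matrix_mul_rid)
  qed
  moreover have "invertible (matrix_inv Z)"
    using matrix_inv_cancel[OF \<open>invertible Z\<close>] by (auto simp: invertible_def)
  ultimately show ?thesis
    using p by blast
qed

section \<open>The factorization\<close>

text \<open>Test with \<open>A = outer z u\<close>, where \<open>z\<close> is orthogonal to \<open>p2\<close> but not to \<open>p1\<close>: the second
  summand disappears and the first becomes \<open>u v* Y1\<close>, up to scaling.\<close>

lemma proportional_right_factors:
  fixes Y1 Y2 Y :: "real ^ 'n ^ 'n" and p1 p2 p :: "real ^ 'm"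
  assumes "\<And>A. p1 v* A v* Y1 + p2 v* A v* Y2 = p v* A v* Y"
    and "p2 \<noteq> 0" and "\<And>c. p1 \<noteq> c *\<^sub>R p2"
  shows "\<exists>c. Y1 = c *\<^sub>R Y"
proof -
  obtain z where z: "p2 \<bullet> z = 0" "p1 \<bullet> z = 1"
    using orthogonal_vector_if_not_multiple assms(2,3) by metis
  have "u v* Y1 = u v* ((p \<bullet> z) *\<^sub>R Y)" for u
    using assms(1)[of "outer z u"] z
    by (simp add: vector_mult_outer scaleR_vector_matrix_assoc linear_scale[OF linear_vector_matrix_arg])
  hence "transpose Y1 *v u = transpose ((p \<bullet> z) *\<^sub>R Y) *v u" for u
    by (simp add: transpose_matrix_vector)
  hence "transpose Y1 = transpose ((p \<bullet> z) *\<^sub>R Y)"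
    by (simp add: matrix_eq)
  thus ?thesis
    by (metis transpose_transpose)
qed

text \<open>Row \<open>i\<close> of \<open>L A\<close> is \<open>p i v* A v* Y i\<close>. Applying the row formula to
  \<open>axis i 1 + axis i0 1\<close> makes \<open>Y i\<close> and \<open>Y i0\<close> multiples of the same matrix. The ratio of the two
  is a real number of unknown sign, which is absorbed into row \<open>i\<close> of \<open>X\<close>; this is why the rows of
  \<open>X\<close> are nonnegative only up to sign.\<close>

lemma preserver_factorization:
  fixes L :: "real ^ 'n ^ 'm \<Rightarrow> real ^ 'n ^ 'm"
  assumes L: "linear L" "surj L" "L ` semipositive_matrices \<subseteq> semipositive_matrices"
  shows "\<exists>(X :: real ^ 'm ^ 'm) (Y :: real ^ 'n ^ 'n). invertible X \<and> invertible Y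
    \<and> (\<forall>A. L A = X ** A ** Y)
    \<and> (\<forall>i. row i X \<noteq> 0 \<and> (row i X \<in> nonneg_orthant \<or> - row i X \<in> nonneg_orthant))"
proof -
  have ax: "axis i 1 \<in> nonneg_orthant" "axis i 1 \<noteq> (0 :: real ^ 'm)" for i :: 'm
    by (simp_all add: nonneg_orthant_def axis_def vec_eq_iff exI[of _ i])
  obtain p Y where p: "\<And>i. p i \<in> nonneg_orthant" "\<And>i. p i \<noteq> 0"
    and Y: "\<And>i. invertible (Y i)" and eq: "\<And>i A. axis i 1 v* L A = p i v* A v* Y i"
    using preserver_row_combination[OF L ax] by metis
  have indep: "p i \<noteq> c *\<^sub>R p k" if "i \<noteq> k" for i k c
  proof
    assume c: "p i = c *\<^sub>R p k"
    \<comment> \<open>Then row \<open>i\<close> of \<open>L A\<close> would vanish together with row \<open>k\<close>, but \<open>L\<close> reaches a matrix whose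
      only nonzero row is row \<open>i\<close>.\<close>
    obtain A where A: "L A = outer (axis i 1) (\<chi> j. 1)"
      by (metis L(2) surjD)
    have "p k v* A v* Y k = 0"
      using that unfolding eq[symmetric] A vector_mult_outer by (simp add: inner_axis_axis)
    hence "p k v* A = 0"
      by (simp add: vector_mult_invertible_eq_0_iff Y)
    hence "axis i 1 v* L A = 0"
      by (simp add: eq c scaleR_vector_matrix_assoc)
    thus False
      unfolding A vector_mult_outer by (simp add: inner_axis_axis vec_eq_iff)
  qed
  define i0 :: 'm where "i0 = undefined"
  have "\<exists>c. c \<noteq> 0 \<and> Y i = c *\<^sub>R Y i0" for i
  proof (cases "i = i0")
    case True
    thus ?thesis by (intro exI[of _ 1]) simp
  next
    case False
    have "axis i 1 + axis i0 1 \<in> nonneg_orthant" "axis i 1 + axis i0 1 \<noteq> (0 :: real ^ 'm)"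
      using False by (auto simp: nonneg_orthant_def axis_def vec_eq_iff)
    then obtain q V where "\<And>A. (axis i 1 + axis i0 1) v* L A = q v* A v* V"
      using preserver_row_combination[OF L] by metis
    hence sum: "p i v* A v* Y i + p i0 v* A v* Y i0 = q v* A v* V" for A
      by (simp add: vector_matrix_left_distrib eq)
    obtain a where a: "Y i = a *\<^sub>R V"
      using proportional_right_factors[OF sum p(2) indep[OF False]] by blast
    obtain b where b: "Y i0 = b *\<^sub>R V"
      using proportional_right_factors[of "p i0" "Y i0" "p i" "Y i"] sum p(2) indep[OF False[symmetric]]
      by (metis add.commute)
    have nz: "Y j \<noteq> 0" for j
    proof
      assume "Y j = 0"
      hence "(\<chi> k. 1) = (0 :: real ^ 'n)"
        using vector_mult_invertible_eq_0_iff[OF Y[of j]] by simp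
      thus False
        by (simp add: vec_eq_iff)
    qed
    have "a \<noteq> 0" "b \<noteq> 0"
      using nz[of i] nz[of i0] a b by auto
    thus ?thesis
      using a b by (intro exI[of _ "a / b"]) simp
  qed
  then obtain c where c: "\<And>i. c i \<noteq> 0" "\<And>i. Y i = c i *\<^sub>R Y i0"
    by metis
  define X :: "real ^ 'm ^ 'm" where "X = (\<chi> i. c i *\<^sub>R p i)"
  have rowX: "row i X = c i *\<^sub>R p i" for i
    by (simp add: X_def row_def vec_eq_iff)
  have LX: "L A = X ** A ** Y i0" for A
  proof -
    have "row i (L A) = row i (X ** A ** Y i0)" for i
    proof -
      have "row i (L A) = (c i *\<^sub>R p i) v* A v* Y i0"
        by (simp add: axis_vector_mult[symmetric] eq c(2)[of i] scaleR_vector_matrix_assoc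
            linear_scale[OF linear_vector_matrix_arg])
      also have "\<dots> = row i (X ** A ** Y i0)"
        by (simp flip: rowX axis_vector_mult vector_matrix_mul_assoc)
      finally show ?thesis .
    qed
    thus ?thesis
      by (simp add: vec_eq_iff row_def)
  qed
  have "invertible X"
  proof -
    have "\<exists>x. b = X *v x" for b
    proof -
      obtain A where A: "L A = outer b (axis undefined 1)"
        by (metis L(2) surjD)
      have "b = L A *v axis undefined 1"
        by (simp add: A outer_mult_vector inner_axis_axis)
      thus ?thesis
        by (metis LX matrix_vector_mul_assoc)
    qed
    thus ?thesis
      by (simp add: invertible_right_inverse matrix_right_invertible_surjective surj_def)
  qed
  moreover have "row i X \<noteq> 0 \<and> (row i X \<in> nonneg_orthant \<or> - row i X \<in> nonneg_orthant)" for i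
    using p[of i] c(1)[of i]
    by (auto simp: rowX nonneg_orthant_def zero_le_mult_iff mult_le_0_iff)
  ultimately show ?thesis
    using Y LX by blast
qed

section \<open>Signs of the factors\<close>

lemma semipositive_outer:
  assumes "b \<in> pos_orthant" and "0 < v $ j"
  shows "semipositive (outer b v)"
proof -
  have "axis j 1 \<in> nonneg_orthant"
    by (simp add: nonneg_orthant_def axis_def)
  moreover have "outer b v *v axis j 1 \<in> pos_orthant"
    using assms by (simp add: outer_mult_vector inner_axis pos_orthant_def)
  ultimately show ?thesis
    unfolding semipositive_def by blast
qed

lemma factor_mult_outer: "X ** outer b v ** Y = outer (X *v b) (v v* Y)"
proof -
  have "(X ** outer b v ** Y) *v u = outer (X *v b) (v v* Y) *v u" for u
    by (simp add: outer_mult_vector dot_lmul_matrix matrix_vector_mult_scaleR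
        flip: matrix_vector_mul_assoc)
  thus ?thesis
    by (simp add: matrix_eq)
qed

text \<open>A negative entry in row \<open>i\<close> of the inverse would give \<open>v = - row i (matrix_inv Y)\<close> a positive
  coordinate, although \<open>v v* Y = - axis i 1\<close> has nonpositive inner product with every nonnegative
  vector.\<close>

lemma inverse_nonnegative_if_detects_positive_coordinates:
  fixes Y :: "real ^ 'n ^ 'n"
  assumes "invertible Y"
    and pos: "\<And>v j. 0 < v $ j \<Longrightarrow> \<exists>u \<in> nonneg_orthant. 0 < (v v* Y) \<bullet> u"
  shows "inverse_nonnegative Y"
proof -
  have "0 \<le> matrix_inv Y $ i $ j" for i j
  proof (rule ccontr)
    assume neg: "\<not> 0 \<le> matrix_inv Y $ i $ j"
    define v where "v = - row i (matrix_inv Y)"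
    obtain u where "u \<in> nonneg_orthant" and u: "0 < (v v* Y) \<bullet> u"
      using pos[of v j] neg by (auto simp: v_def row_def)
    have "v v* Y = - axis i 1"
      by (simp add: v_def vector_matrix_mul_assoc matrix_inv_cancel \<open>invertible Y\<close>
          vector_matrix_mult_minus flip: axis_vector_mult)
    hence "u $ i < 0"
      using u by (simp add: inner_axis')
    thus False
      using \<open>u \<in> nonneg_orthant\<close> by (auto simp: nonneg_orthant_def not_less[symmetric])
  qed
  thus ?thesis
    using \<open>invertible Y\<close> by (simp add: inverse_nonnegative_def entrywise_nonneg_def)
qed

theorem corollary5p1:
  fixes L :: "real ^ 'n ^ 'm \<Rightarrow> real ^ 'n ^ 'm"
  assumes "2 \<le> CARD('m)" and "CARD('m) < CARD('n)"
    and "linear L" and "bij L"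
    and "L ` semipositive_matrices \<subseteq> semipositive_matrices"
  shows "\<exists>(X :: real ^ 'm ^ 'm) (Y :: real ^ 'n ^ 'n).
           invertible X \<and> row_positive X \<and> inverse_nonnegative Y \<and>
           (\<forall>A. L A = X ** A ** Y)"
proof -
  obtain X :: "real ^ 'm ^ 'm" and Y :: "real ^ 'n ^ 'n"
    where X: "invertible X" and Y: "invertible Y" and L: "\<And>A. L A = X ** A ** Y"
      and rows: "\<And>i. row i X \<noteq> 0"
        "\<And>i. row i X \<in> nonneg_orthant \<or> - row i X \<in> nonneg_orthant"
    using preserver_factorization[OF assms(3) bij_is_surj[OF assms(4)] assms(5)] by blast
  define e :: "real ^ 'm" where "e = (\<chi> i. 1)"
  have e: "e \<in> pos_orthant"
    by (simp add: e_def pos_orthant_def)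
  have image: "\<exists>u \<in> nonneg_orthant. \<forall>i. 0 < ((v v* Y) \<bullet> u) * (X *v e) $ i"
    if "0 < v $ j" for v j
  proof -
    have "L (outer e v) \<in> semipositive_matrices"
      using semipositive_outer[OF e that] assms(5) by (auto simp: semipositive_matrices_def)
    thus ?thesis
      by (simp add: L factor_mult_outer semipositive_matrices_def semipositive_def
          outer_mult_vector pos_orthant_def)
  qed
  have "0 < (\<chi> j :: 'n. (1 :: real)) $ undefined"
    by simp
  then obtain r where r: "\<And>i. 0 < r * (X *v e) $ i"
    using image by metis
  \<comment> \<open>\<open>s\<close> is the common sign of all the entries of \<open>X *v e\<close>.\<close>
  define s where "s = sgn r"
  have "r \<noteq> 0"
    using r by force
  hence s: "s * s = 1" "s = 1 \<or> s = -1"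
    by (auto simp: s_def sgn_if)
  have Xe: "0 < s * (X *v e) $ i" for i
    using r[of i] by (auto simp: s_def sgn_if zero_less_mult_iff)
  have srow: "s *\<^sub>R row i X \<in> nonneg_orthant" for i
  proof (rule ccontr)
    assume n: "s *\<^sub>R row i X \<notin> nonneg_orthant"
    hence "- (s *\<^sub>R row i X) \<in> nonneg_orthant"
      using rows(2)[of i] s(2) by auto
    moreover have "- (s *\<^sub>R row i X) \<noteq> 0"
      using rows(1)[of i] s by auto
    ultimately have "0 < - (s *\<^sub>R row i X) \<bullet> e"
      by (rule nonneg_orthant_nonzero_inner_pos[OF _ _ e])
    moreover have "row i X \<bullet> e = (X *v e) $ i"
      by (simp add: row_def matrix_vector_mult_def inner_vec_def)
    ultimately show False
      using Xe[of i] by simp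
  qed
  have "row_positive (s *\<^sub>R X)"
    using srow rows(1) s
    by (auto simp: row_positive_def entrywise_nonneg_def nonneg_orthant_def row_def vec_eq_iff)
  moreover have "invertible (s *\<^sub>R X)" "invertible (s *\<^sub>R Y)"
    using X Y s(2) by (auto intro!: scalar_invertible simp del: scaleR_minus1_left)
  moreover have "inverse_nonnegative (s *\<^sub>R Y)"
  proof (rule inverse_nonnegative_if_detects_positive_coordinates)
    show "invertible (s *\<^sub>R Y)" by fact
    fix v :: "real ^ 'n" and j assume "0 < v $ j"
    then obtain u where "u \<in> nonneg_orthant"
      and "0 < ((v v* Y) \<bullet> u) * (X *v e) $ undefined"
      using image by blast
    hence "0 < s * ((v v* Y) \<bullet> u)"
      using Xe[of undefined] by (auto simp: zero_less_mult_iff)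
    thus "\<exists>u \<in> nonneg_orthant. 0 < (v v* (s *\<^sub>R Y)) \<bullet> u"
      using \<open>u \<in> nonneg_orthant\<close> by (auto simp: linear_scale[OF linear_vector_matrix_arg])
  qed
  moreover have "L A = (s *\<^sub>R X) ** A ** (s *\<^sub>R Y)" for A
    using s(1) by (simp add: L matrix_scalar_ac flip: scalar_matrix_assoc)
  ultimately show ?thesis
    by blast
qed

end
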